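(* Let $n_x,n_y,n_z$ be pairwise relatively prime positive integers, and let $|\mathcal{L}(n_x,n_y,n_z)|$ denote the number of distinct knot types of Lissajous knots with frequencies $(n_x,n_y,n_z)$. Then $$|\mathcal{L}(n_x,n_y,n_z)|\le 2n_xn_y.$$ If furthermore $n_x=2$, then $$|\mathcal{L}(2,n_y,n_z)|\le 2n_y+1.$$
   Context: A Lissajous knot is a knot in $\mathbb{R}^3$ admitting a parameterization $K(t)=(\cos(n_xt+\phi_x),\cos(n_yt+\phi_y),\cos(n_zt+\phi_z))$, $0\le t\le 2\pi$, where the frequencies $n_x,n_y,n_z$ are integers and the phase shifts $\phi_x,\phi_y,\phi_z$ are real numbers (chosen so that the curve is embedded). $\mathcal{L}(n_x,n_y,n_z)$ denotes the set of knot types of all Lissajous knots with frequencies $n_x,n_y,n_z$, where a knot and its mirror image are considered equivalent. *)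

theory Defs
  imports "HOL-Analysis.Analysis"
begin

definition lissajous ::
  "int \<Rightarrow> int \<Rightarrow> int \<Rightarrow> real \<Rightarrow> real \<Rightarrow> real \<Rightarrow> real \<Rightarrow> real \<times> real \<times> real" where
  "lissajous nx ny nz px py pz t =
     (cos (of_int nx * t + px), cos (of_int ny * t + py), cos (of_int nz * t + pz))"

definition lissajous_knots :: "int \<Rightarrow> int \<Rightarrow> int \<Rightarrow> (real \<times> real \<times> real) set set" where
  "lissajous_knots nx ny nz =
     {K. \<exists>px py pz. inj_on (lissajous nx ny nz px py pz) {0..<2*pi} \<and>
                    K = lissajous nx ny nz px py pz ` {0..2*pi}}"

text \<open>Knot equivalence, with a knot identified with its mirror image: there is a
  (not necessarily orientation preserving) self-homeomorphism of R^3 carrying one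
  knot onto the other.\<close>
definition knot_equiv :: "(real \<times> real \<times> real) set \<Rightarrow> (real \<times> real \<times> real) set \<Rightarrow> bool" where
  "knot_equiv K L \<longleftrightarrow> (\<exists>f g. homeomorphism UNIV UNIV f g \<and> f ` K = L)"

definition lissajous_types :: "int \<Rightarrow> int \<Rightarrow> int \<Rightarrow> (real \<times> real \<times> real) set set set" where
  "lissajous_types nx ny nz =
     lissajous_knots nx ny nz // {(K, L). knot_equiv K L}"

end

theory Submission
  imports Defs
begin

text \<open>
  A Lissajous knot survives a perturbation of its phases: the displacement of the curve is a
  Lipschitz-small function on the knot, it extends to space with a small Lipschitz constant, and the
  identity plus a contraction is a homeomorphism. Hence the knot type is constant on connected
  families of embedded curves.

  Up to reflections and shifts of the parameter, a knot with generic phases has phases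
  \<open>(0, - A / nx, c)\<close> with \<open>0 < A < pi\<close>. Inside a larger family of curves the crossings of its
  \<open>xy\<close>-projection split into two kinds whose signs are governed by two independent \<open>2 pi\<close>-periodic
  phases \<open>c\<close> and \<open>e\<close>, where \<open>e = c + nz A / (nx ny)\<close> for the knot itself. The curve is embedded unless
  \<open>nx c\<close> or \<open>ny e\<close> is a multiple of \<open>pi\<close>, so the type depends only on \<open>k = \<lfloor>nx c / pi\<rfloor>\<close> and
  \<open>l = \<lfloor>ny e / pi\<rfloor>\<close>. Adding \<open>pi\<close> to both phases is a reflection, so only \<open>m = ny k - nx l\<close> modulo
  \<open>2 nx ny\<close> matters. Finally, time reversal replaces \<open>m\<close> by \<open>nx - ny - nz - m\<close>; this involution of
  \<open>\<int> / 2 nx ny\<close> has at most two fixed points, which leaves at most \<open>nx ny + 1\<close> knot types.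
\<close>

section \<open>Equivalence of knots up to homeomorphism and reflection\<close>

lemma knot_equiv_sym:
  assumes "knot_equiv K L"
  shows "knot_equiv L K"
proof -
  obtain f g where fg: "homeomorphism UNIV UNIV f g" "f ` K = L"
    using assms unfolding knot_equiv_def by blast
  have "g ` L = K"
    unfolding fg(2)[symmetric] image_image homeomorphism_apply1[OF fg(1) UNIV_I] by simp
  then show ?thesis
    using fg(1) homeomorphism_symD unfolding knot_equiv_def by blast
qed

lemma knot_equiv_trans:
  assumes "knot_equiv K L" "knot_equiv L M"
  shows "knot_equiv K M"
proof -
  obtain f g f' g' where "homeomorphism UNIV UNIV f g" "f ` K = L"
    "homeomorphism UNIV UNIV f' g'" "f' ` L = M"
    using assms unfolding knot_equiv_def by blast
  then have "homeomorphism UNIV UNIV (f' \<circ> f) (g \<circ> g')" "(f' \<circ> f) ` K = M"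
    using homeomorphism_compose by (blast, auto)
  then show ?thesis
    unfolding knot_equiv_def by blast
qed

lemma knot_equiv_reflection:
  fixes \<alpha> \<beta> \<gamma> :: real
  assumes "\<bar>\<alpha>\<bar> = 1" "\<bar>\<beta>\<bar> = 1" "\<bar>\<gamma>\<bar> = 1"
  shows "knot_equiv K ((\<lambda>(x, y, z). (\<alpha> * x, \<beta> * y, \<gamma> * z)) ` K)"
proof -
  let ?f = "\<lambda>(x, y, z). (\<alpha> * x, \<beta> * y, \<gamma> * z)"
  have sq: "\<alpha> * (\<alpha> * x) = x" "\<beta> * (\<beta> * x) = x" "\<gamma> * (\<gamma> * x) = x" for x
    using assms by (auto simp: abs_eq_iff')
  have inv: "?f (?f p) = p" for p
    by (cases p) (simp add: sq)
  have "range ?f = UNIV"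
    using inv by (rule surjI)
  moreover have "continuous_on UNIV ?f"
    unfolding split_def by (intro continuous_intros)
  ultimately have "homeomorphism UNIV UNIV ?f ?f"
    using inv by (simp add: homeomorphism_def)
  then show ?thesis
    unfolding knot_equiv_def by blast
qed

section \<open>Lipschitz-small perturbations of a curve\<close>

text \<open>A preimage of \<open>y\<close> is a fixed point of the contraction
  \<open>x \<mapsto> y - h x\<close>, so Banach's theorem gives surjectivity. The reverse triangle
  inequality bounds \<open>x + h x\<close> below by the factor \<open>1 - q\<close>, which gives
  injectivity and a Lipschitz inverse.\<close>

lemma homeomorphism_id_plus_contraction:
  fixes h :: "'a::banach \<Rightarrow> 'a"
  assumes q: "0 \<le> q" "q < 1"
    and h: "\<And>x y. norm (h x - h y) \<le> q * norm (x - y)"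
  shows "\<exists>g. homeomorphism UNIV UNIV (\<lambda>x. x + h x) g"
proof -
  define f where "f = (\<lambda>x. x + h x)"
  have expand: "(1 - q) * norm (x - y) \<le> norm (f x - f y)" for x y
  proof -
    have "norm (x - y) \<le> norm (f x - f y) + norm (h x - h y)"
      using norm_triangle_ineq4[of "f x - f y" "h x - h y"] by (simp add: f_def)
    then show ?thesis
      using h[of x y] by (simp add: algebra_simps)
  qed
  have inj: "x = y" if "f x = f y" for x y
    using expand[of x y] that q by (simp add: mult_le_0_iff)
  have surj: "\<exists>x. f x = y" for y
  proof -
    have "\<exists>!x. y - h x = x"
      by (rule banach_fix_type[OF q]) (use h in \<open>auto simp: dist_norm norm_minus_commute\<close>)
    then show ?thesis
      by (metis f_def diff_add_cancel)
  qed
  define g where "g = inv f"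
  have fg: "f (g y) = y" for y
    unfolding g_def using surj by (metis f_inv_into_f rangeI)
  have gf: "g (f x) = x" for x
    using inj fg by blast
  have "(1 - q) * norm (g x - g y) \<le> norm (x - y)" for x y
    using expand[of "g x" "g y"] by (simp add: fg)
  then have "norm (g x - g y) \<le> (1 / (1 - q)) * norm (x - y)" for x y
    using q by (simp add: field_simps)
  then have "(1 / (1 - q))-lipschitz_on UNIV g"
    using q by (auto simp: lipschitz_on_def dist_norm)
  moreover have "q-lipschitz_on UNIV h"
    using q h by (auto simp: lipschitz_on_def dist_norm)
  ultimately have "continuous_on UNIV g" "continuous_on UNIV f"
    unfolding f_def by (auto intro!: continuous_on_add continuous_on_id intro: lipschitz_on_continuous_on)
  moreover have "range f = UNIV" "range g = UNIV"
    using fg gf by (metis surjI)+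
  ultimately show ?thesis
    using fg gf by (auto simp: homeomorphism_def f_def[symmetric])
qed

text \<open>McShane's extension: the infimum over \<open>S\<close> of the cones
  \<open>f x + L * dist x y\<close>. The empty set is treated apart because its infimum carries no
  information.\<close>

lemma lipschitz_extension_real:
  fixes f :: "'a::metric_space \<Rightarrow> real"
  assumes "0 \<le> L" and f: "\<And>x y. x \<in> S \<Longrightarrow> y \<in> S \<Longrightarrow> \<bar>f x - f y\<bar> \<le> L * dist x y"
  obtains g where "\<And>x. x \<in> S \<Longrightarrow> g x = f x" "\<And>x y. \<bar>g x - g y\<bar> \<le> L * dist x y"
proof (cases "S = {}")
  case True
  show ?thesis
    by (rule that[of "\<lambda>_. 0"]) (use True assms(1) in auto)
next
  case False
  define g where "g y = (INF x\<in>S. f x + L * dist x y)" for y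
  have lower: "f z - L * dist z y \<le> f x + L * dist x y" if "x \<in> S" "z \<in> S" for x y z
  proof -
    have "L * dist z x \<le> L * (dist z y + dist x y)"
      using assms(1) by (intro mult_left_mono dist_triangle2) auto
    then show ?thesis
      using f[OF that(2,1)] by (simp add: algebra_simps)
  qed
  have bdd: "bdd_below ((\<lambda>x. f x + L * dist x y) ` S)" for y
    using lower False by (meson all_not_in_conv bdd_belowI2)
  have "g x = f x" if "x \<in> S" for x
  proof (rule antisym)
    show "g x \<le> f x"
      unfolding g_def using cINF_lower[OF bdd[of x] that] by simp
    show "f x \<le> g x"
      unfolding g_def using lower[OF _ that, of _ x] by (intro cINF_greatest False) auto
  qed
  moreover have half: "g y \<le> g z + L * dist y z" for y z
  proof -
    have "g y - L * dist y z \<le> f x + L * dist x z" if "x \<in> S" for x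
    proof -
      have "g y \<le> f x + L * dist x y"
        unfolding g_def by (rule cINF_lower[OF bdd that])
      also have "\<dots> \<le> f x + L * (dist x z + dist y z)"
        using assms(1) by (intro add_left_mono mult_left_mono dist_triangle2) auto
      finally show ?thesis
        by (simp add: algebra_simps)
    qed
    then have "g y - L * dist y z \<le> g z"
      unfolding g_def[of z] by (intro cINF_greatest False)
    then show ?thesis
      by simp
  qed
  have "\<bar>g y - g z\<bar> \<le> L * dist y z" for y z
    using half[of y z] half[of z y] by (simp add: dist_commute abs_le_iff)
  ultimately show ?thesis
    using that by blast
qed

text \<open>By \<open>close\<close>, parameters with the same point have the same displacement, so
  the displacement is an \<open>L\<close>-Lipschitz function on the image of the curve. Extending it
  coordinate by coordinate costs the factor \<open>DIM('a)\<close>, and the assumption on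
  \<open>L\<close> keeps the result a contraction.\<close>

lemma lipschitz_perturbation_homeomorphism:
  fixes \<gamma> \<delta> :: "'i \<Rightarrow> 'a::euclidean_space" and L :: real
  assumes L: "0 \<le> L" "DIM('a) * L < 1"
    and close: "\<And>s t. norm ((\<delta> s - \<gamma> s) - (\<delta> t - \<gamma> t)) \<le> L * norm (\<gamma> s - \<gamma> t)"
  shows "\<exists>f g. homeomorphism UNIV UNIV f g \<and> (\<forall>t. f (\<gamma> t) = \<delta> t)"
proof -
  define \<eta> where "\<eta> p = (let t = SOME t. \<gamma> t = p in \<delta> t - \<gamma> t)" for p
  have \<eta>: "\<eta> (\<gamma> t) = \<delta> t - \<gamma> t" for t
  proof -
    have "\<gamma> (SOME s. \<gamma> s = \<gamma> t) = \<gamma> t"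
      by (rule someI) simp
    then show ?thesis
      using close[of "SOME s. \<gamma> s = \<gamma> t" t] by (simp add: \<eta>_def Let_def)
  qed
  have "\<exists>G. (\<forall>p\<in>range \<gamma>. G p = \<eta> p \<bullet> b) \<and> (\<forall>x y. \<bar>G x - G y\<bar> \<le> L * dist x y)"
    if "b \<in> Basis" for b
  proof -
    have "\<bar>\<eta> p \<bullet> b - \<eta> q \<bullet> b\<bar> \<le> L * dist p q" if "p \<in> range \<gamma>" "q \<in> range \<gamma>" for p q
    proof -
      have "\<bar>(\<eta> p - \<eta> q) \<bullet> b\<bar> \<le> norm (\<eta> p - \<eta> q)"
        using \<open>b \<in> Basis\<close> by (rule Basis_le_norm)
      also have "\<dots> \<le> L * dist p q"
        using that close by (auto simp: \<eta> dist_norm)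
      finally show ?thesis
        by (simp add: inner_diff_left)
    qed
    then show ?thesis
      using lipschitz_extension_real[OF L(1), of "range \<gamma>" "\<lambda>p. \<eta> p \<bullet> b"] by metis
  qed
  then obtain G where G: "\<And>b p. b \<in> Basis \<Longrightarrow> p \<in> range \<gamma> \<Longrightarrow> G b p = \<eta> p \<bullet> b"
    "\<And>b x y. b \<in> Basis \<Longrightarrow> \<bar>G b x - G b y\<bar> \<le> L * dist x y"
    by metis
  define h where "h x = (\<Sum>b\<in>Basis. G b x *\<^sub>R b)" for x
  have "norm (h x - h y) \<le> DIM('a) * L * norm (x - y)" for x y
  proof -
    have "norm (h x - h y) \<le> (\<Sum>b\<in>Basis. norm ((G b x - G b y) *\<^sub>R b))"
      unfolding h_def sum_subtractf[symmetric] scaleR_diff_left[symmetric] by (rule norm_sum)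
    also have "\<dots> \<le> (\<Sum>b\<in>(Basis::'a set). L * norm (x - y))"
      using G(2) by (intro sum_mono) (simp add: dist_norm)
    finally show ?thesis
      by simp
  qed
  then obtain g where "homeomorphism UNIV UNIV (\<lambda>x. x + h x) g"
    using homeomorphism_id_plus_contraction[of "DIM('a) * L" h] L by auto
  moreover have "\<gamma> t + h (\<gamma> t) = \<delta> t" for t
    by (simp add: h_def G(1) \<eta> euclidean_representation)
  ultimately show ?thesis
    by blast
qed

section \<open>Chordal estimates for closed curves\<close>

lemma abs_cos_int_pi: "\<bar>cos (of_int k * pi)\<bar> = 1"
  and cos_add_int_pi: "cos (x + of_int k * pi) = cos (of_int k * pi) * cos x"
  and abs_sin_add_int_pi: "\<bar>sin (x + of_int k * pi)\<bar> = \<bar>sin x\<bar>"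
proof -
  have sin0: "sin (of_int k * pi) = 0"
    using sin_zero_iff_int2 by blast
  then show cos1: "\<bar>cos (of_int k * pi)\<bar> = 1"
    by (rule sin_zero_abs_cos_one)
  show "cos (x + of_int k * pi) = cos (of_int k * pi) * cos x"
      "\<bar>sin (x + of_int k * pi)\<bar> = \<bar>sin x\<bar>"
    by (simp_all add: cos_add sin_add abs_mult sin0 cos1)
qed

lemma periodic_add_int_multiple:
  fixes \<gamma> :: "real \<Rightarrow> 'a"
  assumes "\<And>t. \<gamma> (t + p) = \<gamma> t"
  shows "\<gamma> (t + of_int k * p) = \<gamma> t"
proof (induction k rule: int_induct[where k = 0])
  case (step1 i)
  then show ?case
    using assms[of "t + of_int i * p"] by (simp add: algebra_simps)
next
  case (step2 i)
  then show ?case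
    using assms[of "t + of_int (i - 1) * p"] by (simp add: algebra_simps)
qed simp

lemma periodic_reduce:
  obtains k :: int where "t - of_int k * (2 * pi) \<in> {0..<2 * pi}"
proof
  have "frac (t / (2 * pi)) * (2 * pi) = t - of_int \<lfloor>t / (2 * pi)\<rfloor> * (2 * pi)"
    by (simp add: frac_def algebra_simps)
  moreover have "0 \<le> frac (t / (2 * pi)) * (2 * pi)" "frac (t / (2 * pi)) * (2 * pi) < 2 * pi"
    using frac_lt_1[of "t / (2 * pi)"] pi_gt_zero by (simp_all add: mult_less_cancel_right1)
  ultimately show "t - of_int \<lfloor>t / (2 * pi)\<rfloor> * (2 * pi) \<in> {0..<2 * pi}"
    by simp
qed

lemma periodic_image_eq_range:
  assumes "\<And>t. \<gamma> (t + 2 * pi) = \<gamma> t"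
  shows "\<gamma> ` {0..2 * pi} = range \<gamma>"
proof -
  have "\<gamma> t \<in> \<gamma> ` {0..2 * pi}" for t
  proof -
    obtain k :: int where "t - of_int k * (2 * pi) \<in> {0..<2 * pi}"
      by (rule periodic_reduce)
    moreover have "\<gamma> (t - of_int k * (2 * pi)) = \<gamma> t"
      using periodic_add_int_multiple[of \<gamma> "2 * pi", OF assms, of t "- k"] by simp
    ultimately show ?thesis
      by (intro image_eqI[of _ _ "t - of_int k * (2 * pi)"]) auto
  qed
  then show ?thesis
    by blast
qed

text \<open>The vanishing of \<open>sin ((t - s) / 2)\<close> encodes equality of \<open>t\<close>
  and \<open>s\<close> modulo \<open>2 * pi\<close>.\<close>

lemma periodic_inj_on_imp_sin_eq_0:
  assumes per: "\<And>t. \<gamma> (t + 2 * pi) = \<gamma> t"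
    and inj: "inj_on \<gamma> {0..<2 * pi}" and eq: "\<gamma> t = \<gamma> s"
  shows "sin ((t - s) / 2) = 0"
proof -
  obtain k l :: int where kl: "t - of_int k * (2 * pi) \<in> {0..<2 * pi}"
      "s - of_int l * (2 * pi) \<in> {0..<2 * pi}"
    using periodic_reduce by metis
  have "\<gamma> (t - of_int k * (2 * pi)) = \<gamma> (s - of_int l * (2 * pi))"
    using eq periodic_add_int_multiple[of \<gamma> "2 * pi", OF per, of t "- k"]
      periodic_add_int_multiple[of \<gamma> "2 * pi", OF per, of s "- l"] by simp
  then have "t - of_int k * (2 * pi) = s - of_int l * (2 * pi)"
    using inj kl by (meson inj_onD)
  then have "(t - s) / 2 = of_int (k - l) * pi"
    by (simp add: field_simps)
  then show ?thesis
    using sin_zero_iff_int2 by blast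
qed

section \<open>The quotient of sin (n u) by sin u, and chordal Lipschitz bounds\<close>

primrec sin_ratio :: "nat \<Rightarrow> real \<Rightarrow> real" where
  "sin_ratio 0 u = 0"
| "sin_ratio (Suc n) u = sin_ratio n u * cos u + cos (real n * u)"

lemma sin_mult_eq_sin_ratio: "sin (real n * u) = sin u * sin_ratio n u"
  by (induction n) (simp_all add: algebra_simps sin_add)

text \<open>Where \<open>sin u = 0\<close>, \<open>cos u\<close> is 1 or -1 and the recursion
  evaluates to \<open>n * cos u ^ (n - 1)\<close>. This is the point of defining the quotient
  recursively, as a Chebyshev polynomial of the second kind in \<open>cos u\<close>: it stays
  meaningful at the zeros of \<open>sin u\<close>.\<close>

lemma sin_ratio_nonzero:
  assumes "sin u = 0" "n > 0"
  shows "sin_ratio n u \<noteq> 0"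
proof -
  have cos_mult: "cos (real n * u) = cos u ^ n" for n
    by (induction n) (simp_all add: algebra_simps cos_add assms)
  have "sin_ratio (Suc n) u = real (Suc n) * cos u ^ n" for n
  proof (induction n)
    case (Suc n)
    have "sin_ratio (Suc (Suc n)) u = sin_ratio (Suc n) u * cos u + cos u ^ Suc n"
      by (simp only: sin_ratio.simps(2)[of "Suc n"] cos_mult)
    then show ?case
      unfolding Suc by (simp add: algebra_simps)
  qed simp
  moreover have "cos u \<noteq> 0"
    using assms sin_zero_abs_cos_one by fastforce
  ultimately show ?thesis
    using assms(2) by (cases n) (simp_all del: sin_ratio.simps)
qed

lemma abs_sin_ratio_le: "\<bar>sin_ratio n u\<bar> \<le> real n"
proof (induction n)
  case (Suc n)
  have "\<bar>sin_ratio n u * cos u\<bar> \<le> real n * 1"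
    unfolding abs_mult using Suc by (intro mult_mono) auto
  then show ?case
    using abs_triangle_ineq[of "sin_ratio n u * cos u" "cos (real n * u)"] abs_cos_le_one[of "real n * u"]
    unfolding sin_ratio.simps by linarith
qed simp

lemma continuous_on_sin_ratio [continuous_intros]:
  fixes f :: "'a::t2_space \<Rightarrow> real"
  assumes "continuous_on S f"
  shows "continuous_on S (\<lambda>x. sin_ratio n (f x))"
  using assms by (induction n) (auto intro!: continuous_intros)

lemma abs_sin_int_mult_le: "\<bar>sin (of_int n * u)\<bar> \<le> real_of_int \<bar>n\<bar> * \<bar>sin u\<bar>"
proof -
  have "\<bar>sin (of_int n * u)\<bar> = \<bar>sin (real (nat \<bar>n\<bar>) * u)\<bar>"
    by (cases "n \<ge> 0") simp_all
  also have "\<dots> \<le> \<bar>sin u\<bar> * real (nat \<bar>n\<bar>)"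
    unfolding sin_mult_eq_sin_ratio abs_mult by (intro mult_left_mono abs_sin_ratio_le) simp
  finally show ?thesis
    by (simp add: mult.commute)
qed

text \<open>\<open>\<bar>sin ((t - s) / 2)\<bar>\<close> is half the chord between the points at
  angles \<open>t\<close> and \<open>s\<close> on the unit circle, hence a metric on the parameter
  circle that respects the period.\<close>

definition chord_lipschitz :: "(real \<Rightarrow> real) \<Rightarrow> bool" where
  "chord_lipschitz \<phi> \<longleftrightarrow> (\<exists>C. \<forall>t s. \<bar>\<phi> t - \<phi> s\<bar> \<le> C * \<bar>sin ((t - s) / 2)\<bar>)"

lemma chord_lipschitz_cos: "chord_lipschitz (\<lambda>t. cos (of_int n * t))"
proof -
  have "\<bar>cos (of_int n * t) - cos (of_int n * s)\<bar> \<le> (2 * real_of_int \<bar>n\<bar>) * \<bar>sin ((t - s) / 2)\<bar>" for t s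
  proof -
    have "\<bar>cos (of_int n * s) - cos (of_int n * t)\<bar>
        = 2 * \<bar>sin ((of_int n * s + of_int n * t) / 2)\<bar> * \<bar>sin (of_int n * ((t - s) / 2))\<bar>"
      by (simp add: cos_diff_cos abs_mult algebra_simps)
    also have "\<dots> \<le> 2 * 1 * (real_of_int \<bar>n\<bar> * \<bar>sin ((t - s) / 2)\<bar>)"
      by (intro mult_mono abs_sin_int_mult_le) auto
    finally show ?thesis
      by (simp add: abs_minus_commute)
  qed
  then show ?thesis
    unfolding chord_lipschitz_def by blast
qed

lemma chord_lipschitz_sin: "chord_lipschitz (\<lambda>t. sin (of_int n * t))"
proof -
  have "\<bar>sin (of_int n * t) - sin (of_int n * s)\<bar> \<le> (2 * real_of_int \<bar>n\<bar>) * \<bar>sin ((t - s) / 2)\<bar>" for t s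
  proof -
    have "\<bar>sin (of_int n * t) - sin (of_int n * s)\<bar>
        = 2 * \<bar>sin (of_int n * ((t - s) / 2))\<bar> * \<bar>cos ((of_int n * t + of_int n * s) / 2)\<bar>"
      by (simp add: sin_diff_sin abs_mult algebra_simps)
    also have "\<dots> \<le> 2 * (real_of_int \<bar>n\<bar> * \<bar>sin ((t - s) / 2)\<bar>) * 1"
      by (intro mult_mono abs_sin_int_mult_le) auto
    finally show ?thesis
      by simp
  qed
  then show ?thesis
    unfolding chord_lipschitz_def by blast
qed

lemma chord_lipschitz_mult:
  assumes "chord_lipschitz \<phi>" "chord_lipschitz \<psi>"
  shows "chord_lipschitz (\<lambda>t. \<phi> t * \<psi> t)"
proof -
  obtain C D where C: "\<And>t s. \<bar>\<phi> t - \<phi> s\<bar> \<le> C * \<bar>sin ((t - s) / 2)\<bar>"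
    and D: "\<And>t s. \<bar>\<psi> t - \<psi> s\<bar> \<le> D * \<bar>sin ((t - s) / 2)\<bar>"
    using assms unfolding chord_lipschitz_def by blast
  \<comment> \<open>The chordal metric is bounded, so a chord-Lipschitz function is bounded too; the
    product estimate needs this.\<close>
  have bound: "\<bar>f t\<bar> \<le> \<bar>f 0\<bar> + \<bar>E\<bar>"
    if "\<And>t s. \<bar>f t - f s\<bar> \<le> E * \<bar>sin ((t - s) / 2)\<bar>" for f E and t :: real
  proof -
    have "E * \<bar>sin (t / 2)\<bar> \<le> \<bar>E\<bar> * 1"
      by (intro mult_mono) auto
    then show ?thesis
      using that[of t 0] by simp
  qed
  define P Q where "P = \<bar>\<phi> 0\<bar> + \<bar>C\<bar>" and "Q = \<bar>\<psi> 0\<bar> + \<bar>D\<bar>"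
  have "\<bar>\<phi> t * \<psi> t - \<phi> s * \<psi> s\<bar> \<le> (P * D + C * Q) * \<bar>sin ((t - s) / 2)\<bar>" for t s
  proof -
    have "\<bar>\<phi> t * \<psi> t - \<phi> s * \<psi> s\<bar> = \<bar>\<phi> t * (\<psi> t - \<psi> s) + (\<phi> t - \<phi> s) * \<psi> s\<bar>"
      by (simp add: algebra_simps)
    also have "\<dots> \<le> \<bar>\<phi> t\<bar> * \<bar>\<psi> t - \<psi> s\<bar> + \<bar>\<phi> t - \<phi> s\<bar> * \<bar>\<psi> s\<bar>"
      by (metis abs_mult abs_triangle_ineq)
    also have "\<dots> \<le> P * (D * \<bar>sin ((t - s) / 2)\<bar>) + (C * \<bar>sin ((t - s) / 2)\<bar>) * Q"
      using bound[OF C, of t] bound[OF D, of s] C[of t s] D[of t s]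
        order_trans[OF abs_ge_zero C[of t s]]
      by (intro add_mono mult_mono) (simp_all add: P_def Q_def)
    finally show ?thesis
      by (simp add: algebra_simps)
  qed
  then show ?thesis
    unfolding chord_lipschitz_def by blast
qed

text \<open>Convergence in the Lipschitz seminorm of the chordal metric. Uniform convergence would
  be too weak, since the displacement must be small relative to the distance of nearby
  points.\<close>

definition chord_tendsto :: "('p \<Rightarrow> real \<Rightarrow> real) \<Rightarrow> (real \<Rightarrow> real) \<Rightarrow> 'p filter \<Rightarrow> bool" where
  "chord_tendsto f g F \<longleftrightarrow>
     (\<forall>\<epsilon>>0. \<forall>\<^sub>F p in F. \<forall>t s. \<bar>(f p t - g t) - (f p s - g s)\<bar> \<le> \<epsilon> * \<bar>sin ((t - s) / 2)\<bar>)"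

lemma chord_tendsto_mult:
  assumes "(c \<longlongrightarrow> c\<^sub>0) F" "chord_lipschitz \<phi>"
  shows "chord_tendsto (\<lambda>p t. c p * \<phi> t) (\<lambda>t. c\<^sub>0 * \<phi> t) F"
  unfolding chord_tendsto_def
proof (intro allI impI)
  fix \<epsilon> :: real
  assume "\<epsilon> > 0"
  obtain C where C: "\<And>t s. \<bar>\<phi> t - \<phi> s\<bar> \<le> C * \<bar>sin ((t - s) / 2)\<bar>"
    using assms(2) unfolding chord_lipschitz_def by blast
  have "\<forall>\<^sub>F p in F. dist (c p) c\<^sub>0 < \<epsilon> / (\<bar>C\<bar> + 1)"
    using assms(1) \<open>\<epsilon> > 0\<close> by (intro tendstoD) auto
  then show "\<forall>\<^sub>F p in F. \<forall>t s. \<bar>(c p * \<phi> t - c\<^sub>0 * \<phi> t) - (c p * \<phi> s - c\<^sub>0 * \<phi> s)\<bar>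
      \<le> \<epsilon> * \<bar>sin ((t - s) / 2)\<bar>"
  proof (rule eventually_mono, intro allI)
    fix p t s
    assume p: "dist (c p) c\<^sub>0 < \<epsilon> / (\<bar>C\<bar> + 1)"
    have "\<bar>(c p * \<phi> t - c\<^sub>0 * \<phi> t) - (c p * \<phi> s - c\<^sub>0 * \<phi> s)\<bar> = \<bar>c p - c\<^sub>0\<bar> * \<bar>\<phi> t - \<phi> s\<bar>"
      by (simp add: abs_mult[symmetric] algebra_simps)
    also have "\<dots> \<le> (\<epsilon> / (\<bar>C\<bar> + 1)) * ((\<bar>C\<bar> + 1) * \<bar>sin ((t - s) / 2)\<bar>)"
    proof (intro mult_mono)
      have "C * \<bar>sin ((t - s) / 2)\<bar> \<le> (\<bar>C\<bar> + 1) * \<bar>sin ((t - s) / 2)\<bar>"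
        by (intro mult_right_mono) auto
      then show "\<bar>\<phi> t - \<phi> s\<bar> \<le> (\<bar>C\<bar> + 1) * \<bar>sin ((t - s) / 2)\<bar>"
        using C[of t s] by linarith
    qed (use p \<open>\<epsilon> > 0\<close> in \<open>auto simp: dist_real_def\<close>)
    also have "\<dots> = \<epsilon> * \<bar>sin ((t - s) / 2)\<bar>"
      by simp
    finally show "\<bar>(c p * \<phi> t - c\<^sub>0 * \<phi> t) - (c p * \<phi> s - c\<^sub>0 * \<phi> s)\<bar> \<le> \<epsilon> * \<bar>sin ((t - s) / 2)\<bar>" .
  qed
qed

lemma chord_tendsto_add:
  assumes "chord_tendsto f g F" "chord_tendsto f' g' F"
  shows "chord_tendsto (\<lambda>p t. f p t + f' p t) (\<lambda>t. g t + g' t) F"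
  unfolding chord_tendsto_def
proof (intro allI impI)
  fix \<epsilon> :: real
  assume "\<epsilon> > 0"
  then have "\<epsilon> / 2 > 0"
    by simp
  with assms have "\<forall>\<^sub>F p in F. \<forall>t s. \<bar>(f p t - g t) - (f p s - g s)\<bar> \<le> \<epsilon> / 2 * \<bar>sin ((t - s) / 2)\<bar>"
    "\<forall>\<^sub>F p in F. \<forall>t s. \<bar>(f' p t - g' t) - (f' p s - g' s)\<bar> \<le> \<epsilon> / 2 * \<bar>sin ((t - s) / 2)\<bar>"
    unfolding chord_tendsto_def by blast+
  then show "\<forall>\<^sub>F p in F. \<forall>t s. \<bar>(f p t + f' p t - (g t + g' t)) - (f p s + f' p s - (g s + g' s))\<bar>
      \<le> \<epsilon> * \<bar>sin ((t - s) / 2)\<bar>"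
  proof eventually_elim
    case (elim p)
    show ?case
    proof (intro allI)
      fix t s
      show "\<bar>(f p t + f' p t - (g t + g' t)) - (f p s + f' p s - (g s + g' s))\<bar>
          \<le> \<epsilon> * \<bar>sin ((t - s) / 2)\<bar>"
        using elim(1)[rule_format, of t s] elim(2)[rule_format, of t s]
        unfolding abs_le_iff by (simp add: algebra_simps)
    qed
  qed
qed

text \<open>For a smooth closed curve this single bound forces both injectivity modulo
  \<open>2 * pi\<close> and nonzero velocity; being quantitative, it leaves room for
  perturbations.\<close>

definition chord_embedding :: "(real \<Rightarrow> 'a::real_normed_vector) \<Rightarrow> bool" where
  "chord_embedding \<gamma> \<longleftrightarrow> (\<exists>c>0. \<forall>t s. c * \<bar>sin ((t - s) / 2)\<bar> \<le> norm (\<gamma> t - \<gamma> s))"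

lemma chord_embedding_perturb:
  fixes x\<^sub>0 y\<^sub>0 z\<^sub>0 :: "real \<Rightarrow> real"
  assumes emb: "chord_embedding (\<lambda>t. (x\<^sub>0 t, y\<^sub>0 t, z\<^sub>0 t))"
    and lim: "chord_tendsto x x\<^sub>0 F" "chord_tendsto y y\<^sub>0 F" "chord_tendsto z z\<^sub>0 F"
  shows "\<forall>\<^sub>F p in F. knot_equiv (range (\<lambda>t. (x\<^sub>0 t, y\<^sub>0 t, z\<^sub>0 t))) (range (\<lambda>t. (x p t, y p t, z p t)))"
proof -
  define \<gamma> where "\<gamma> t = (x\<^sub>0 t, y\<^sub>0 t, z\<^sub>0 t)" for t
  obtain c where "c > 0" and c: "\<And>t s. c * \<bar>sin ((t - s) / 2)\<bar> \<le> norm (\<gamma> t - \<gamma> s)"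
    using emb unfolding chord_embedding_def \<gamma>_def by blast
  \<comment> \<open>Three coordinates, each moved by at most \<open>c / 12\<close> times the chord,
    give relative Lipschitz constant \<open>1 / 4\<close>, and in dimension three
    \<open>3 * (1 / 4) < 1\<close>.\<close>
  then have "c / 12 > 0"
    by simp
  with lim have
    "\<forall>\<^sub>F p in F. \<forall>t s. \<bar>(x p t - x\<^sub>0 t) - (x p s - x\<^sub>0 s)\<bar> \<le> c / 12 * \<bar>sin ((t - s) / 2)\<bar>"
    "\<forall>\<^sub>F p in F. \<forall>t s. \<bar>(y p t - y\<^sub>0 t) - (y p s - y\<^sub>0 s)\<bar> \<le> c / 12 * \<bar>sin ((t - s) / 2)\<bar>"
    "\<forall>\<^sub>F p in F. \<forall>t s. \<bar>(z p t - z\<^sub>0 t) - (z p s - z\<^sub>0 s)\<bar> \<le> c / 12 * \<bar>sin ((t - s) / 2)\<bar>"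
    unfolding chord_tendsto_def by blast+
  then show ?thesis
  proof eventually_elim
    case (elim p)
    define \<delta> where "\<delta> t = (x p t, y p t, z p t)" for t
    have "norm ((\<delta> s - \<gamma> s) - (\<delta> t - \<gamma> t)) \<le> 1 / 4 * norm (\<gamma> s - \<gamma> t)" for s t
    proof -
      have norm3: "norm (a, b, d) \<le> \<bar>a\<bar> + \<bar>b\<bar> + \<bar>d\<bar>" for a b d :: real
        using norm_Pair_le[of a "(b, d)"] norm_Pair_le[of b d] by simp
      have "norm ((\<delta> s - \<gamma> s) - (\<delta> t - \<gamma> t)) \<le> 3 * (c / 12 * \<bar>sin ((s - t) / 2)\<bar>)"
        unfolding \<delta>_def \<gamma>_def diff_Pair
        using norm3[of "(x p s - x\<^sub>0 s) - (x p t - x\<^sub>0 t)" "(y p s - y\<^sub>0 s) - (y p t - y\<^sub>0 t)"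
            "(z p s - z\<^sub>0 s) - (z p t - z\<^sub>0 t)"]
          elim(1)[rule_format, of s t] elim(2)[rule_format, of s t] elim(3)[rule_format, of s t]
        by linarith
      then show ?thesis
        using c[of s t] by simp
    qed
    then have "\<exists>f g. homeomorphism UNIV UNIV f g \<and> (\<forall>t. f (\<gamma> t) = \<delta> t)"
      by (intro lipschitz_perturbation_homeomorphism[where L = "1 / 4"]) simp_all
    then obtain f g where "homeomorphism UNIV UNIV f g" "\<And>t. f (\<gamma> t) = \<delta> t"
      by blast
    then have "knot_equiv (range \<gamma>) (range \<delta>)"
      unfolding knot_equiv_def by (metis (no_types, lifting) image_cong image_image)
    then show ?case
      by (simp add: \<gamma>_def \<delta>_def)
  qed
qed

text \<open>\<open>\<Phi>\<close> stands for the chord of the curve divided by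
  \<open>\<bar>sin u\<bar>\<close>, continued across the diagonal. Its minimum on a compact set is
  positive, and periodicity carries the bound to all parameters.\<close>

lemma chord_embeddingI:
  fixes \<gamma> :: "real \<Rightarrow> 'a::real_normed_vector" and \<Phi> :: "real \<times> real \<Rightarrow> real"
  assumes per: "\<And>t. \<gamma> (t + 2 * pi) = \<gamma> t"
    and cont: "continuous_on UNIV \<Phi>" and pos: "\<And>u v. \<Phi> (u, v) > 0"
    and lower: "\<And>u v. \<bar>sin u\<bar> * \<Phi> (u, v) \<le> norm (\<gamma> (v + u) - \<gamma> (v - u))"
  shows "chord_embedding \<gamma>"
proof -
  \<comment> \<open>The coordinates are half the difference and the midpoint of two parameters in
    one period.\<close>
  define Q where "Q = {- pi..pi} \<times> {0..2 * pi}"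
  have "compact Q" "(0, 0) \<in> Q"
    unfolding Q_def by (auto intro: compact_Times)
  then obtain q where q: "q \<in> Q" "\<And>r. r \<in> Q \<Longrightarrow> \<Phi> q \<le> \<Phi> r"
    using continuous_attains_inf[of Q \<Phi>] cont continuous_on_subset by blast
  have base: "\<Phi> q * \<bar>sin ((t - s) / 2)\<bar> \<le> norm (\<gamma> t - \<gamma> s)"
    if "t \<in> {0..<2 * pi}" "s \<in> {0..<2 * pi}" for t s
  proof -
    have "((t - s) / 2, (t + s) / 2) \<in> Q"
      using that unfolding Q_def by auto
    then have "\<Phi> q * \<bar>sin ((t - s) / 2)\<bar> \<le> \<Phi> ((t - s) / 2, (t + s) / 2) * \<bar>sin ((t - s) / 2)\<bar>"
      using q(2) by (intro mult_right_mono) auto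
    also have "\<dots> \<le> norm (\<gamma> ((t + s) / 2 + (t - s) / 2) - \<gamma> ((t + s) / 2 - (t - s) / 2))"
      using lower by (simp add: mult.commute)
    finally show ?thesis
      by (simp add: field_simps)
  qed
  have "\<Phi> q * \<bar>sin ((t - s) / 2)\<bar> \<le> norm (\<gamma> t - \<gamma> s)" for t s
  proof -
    obtain k l :: int where kl: "t - of_int k * (2 * pi) \<in> {0..<2 * pi}"
        "s - of_int l * (2 * pi) \<in> {0..<2 * pi}"
      using periodic_reduce by metis
    have "\<gamma> (t - of_int k * (2 * pi)) = \<gamma> t" "\<gamma> (s - of_int l * (2 * pi)) = \<gamma> s"
      using periodic_add_int_multiple[of \<gamma> "2 * pi", OF per, of t "- k"]
        periodic_add_int_multiple[of \<gamma> "2 * pi", OF per, of s "- l"] by simp_all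
    moreover have "((t - of_int k * (2 * pi)) - (s - of_int l * (2 * pi))) / 2
        = (t - s) / 2 + of_int (l - k) * pi"
      by (simp add: field_simps)
    ultimately show ?thesis
      using base[OF kl] by (metis abs_sin_add_int_pi)
  qed
  moreover have "\<Phi> q > 0"
    using pos by (metis surj_pair)
  ultimately show ?thesis
    unfolding chord_embedding_def by blast
qed

section \<open>Lissajous curves and a two-phase family\<close>

text \<open>By Bezout, \<open>u\<close> is an integer combination of \<open>m * u\<close> and
  \<open>n * u\<close>, both integer multiples of \<open>pi\<close>.\<close>

lemma sin_coprime_multiples_eq_0:
  fixes m n :: int and u :: real
  assumes "coprime m n" "sin (of_int m * u) = 0" "sin (of_int n * u) = 0"
  shows "sin u = 0"
proof -
  obtain i j :: int where ij: "of_int m * u = of_int i * pi" "of_int n * u = of_int j * pi"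
    using assms sin_zero_iff_int2 by blast
  obtain x y where "x * m + y * n = 1"
    using bezout_int[of m n] assms(1) by auto
  then have "u = of_int (x * m + y * n) * u"
    by simp
  also have "\<dots> = of_int x * (of_int m * u) + of_int y * (of_int n * u)"
    by (simp add: algebra_simps)
  also have "\<dots> = of_int (x * i + y * j) * pi"
    unfolding ij by (simp add: algebra_simps)
  finally show ?thesis
    using sin_zero_iff_int2 by blast
qed

lemma cos_chord:
  fixes n :: int and u v b :: real
  shows "cos (of_int n * (v + u) + b) - cos (of_int n * (v - u) + b)
    = - 2 * sin (of_int n * v + b) * sin (of_int n * u)"
proof -
  have "of_int n * (v + u) + b = (of_int n * v + b) + of_int n * u"
    "of_int n * (v - u) + b = (of_int n * v + b) - of_int n * u"
    by (simp_all add: algebra_simps)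
  then show ?thesis
    by (simp only: cos_add cos_diff)
qed

lemma sin_int_mult_eq_sin_ratio:
  "n \<ge> 0 \<Longrightarrow> sin (of_int n * u) = sin u * sin_ratio (nat n) u"
  using sin_mult_eq_sin_ratio[of "nat n" u] by simp

lemma cos_int_mult_periodic: "cos (of_int n * (t + 2 * pi) + b) = cos (of_int n * t + b)"
proof -
  have "of_int n * (t + 2 * pi) + b = (of_int n * t + b) + of_int n * (2 * pi)"
    by (simp add: algebra_simps)
  then show ?thesis
    by (simp only: periodic_add_int_multiple[where \<gamma> = cos, OF cos_periodic])
qed

text \<open>Used to divide a chord by \<open>sin u\<close> in the first two coordinates only,
  leaving the height difference untouched: shrinking the third coordinate can only decrease the
  norm.\<close>

lemma abs_mult_norm_triple_le:
  fixes s x y z :: real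
  assumes "\<bar>s\<bar> \<le> 1"
  shows "\<bar>s\<bar> * norm (x, y, z) \<le> norm (s * x, s * y, z)"
proof -
  have "\<bar>s\<bar> * norm (x, y, z) = norm (s *\<^sub>R (x, y, z))"
    by (simp only: norm_scaleR)
  also have "\<dots> = norm (s * x, s * y, s * z)"
    by simp
  also have "\<dots> \<le> norm (s * x, s * y, z)"
  proof -
    have "(s * z)\<^sup>2 \<le> z\<^sup>2"
      using assms by (simp add: power_mult_distrib mult_left_le_one_le abs_square_le_1)
    then show ?thesis
      by (simp add: norm_Pair)
  qed
  finally show ?thesis .
qed

locale pairwise_coprime_frequencies =
  fixes nx ny nz :: int
  assumes freq_pos: "0 < nx" "0 < ny" "0 < nz"
    and freq_coprime: "coprime nx ny" "coprime nx nz" "coprime ny nz"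
begin

lemma lissajous_periodic: "lissajous nx ny nz a b c (t + 2 * pi) = lissajous nx ny nz a b c t"
  unfolding lissajous_def cos_int_mult_periodic by (rule refl)

lemma lissajous_knots_eq:
  "lissajous_knots nx ny nz =
     {range (lissajous nx ny nz a b c) | a b c. inj_on (lissajous nx ny nz a b c) {0..<2 * pi}}"
  unfolding lissajous_knots_def
    periodic_image_eq_range[of "lissajous nx ny nz _ _ _", OF lissajous_periodic] by blast

text \<open>Injectivity already excludes zero velocity. If all three derivatives vanish at
  \<open>v\<close>, the curve is symmetric about \<open>v\<close>, so the parameters
  \<open>v + pi / 2\<close> and \<open>v - pi / 2\<close> give the same point. Hence the chord
  divided by \<open>sin u\<close> never vanishes.\<close>

lemma lissajous_chord_embedding:
  assumes inj: "inj_on (lissajous nx ny nz a b c) {0..<2 * pi}"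
  shows "chord_embedding (lissajous nx ny nz a b c)"
proof -
  let ?\<gamma> = "lissajous nx ny nz a b c"
  define W where "W = (\<lambda>(u, v). (sin (of_int nx * v + a) * sin_ratio (nat nx) u,
    sin (of_int ny * v + b) * sin_ratio (nat ny) u, sin (of_int nz * v + c) * sin_ratio (nat nz) u))"
  have diff: "?\<gamma> (v + u) - ?\<gamma> (v - u) = (- 2 * sin u) *\<^sub>R W (u, v)" for u v
    unfolding lissajous_def W_def diff_Pair cos_chord
    using freq_pos by (simp add: sin_int_mult_eq_sin_ratio)
  have nz: "W (u, v) \<noteq> 0" for u v
  proof
    assume W0: "W (u, v) = 0"
    show False
    proof (cases "sin u = 0")
      case False
      have "?\<gamma> (v + u) = ?\<gamma> (v - u)"
        using diff[of v u] W0 by simp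
      then show False
        using periodic_inj_on_imp_sin_eq_0[OF lissajous_periodic inj, of "v + u" "v - u"] False by simp
    next
      case True
      then have "sin (of_int nx * v + a) = 0" "sin (of_int ny * v + b) = 0" "sin (of_int nz * v + c) = 0"
        using W0 sin_ratio_nonzero[OF True] freq_pos unfolding W_def by (auto simp: zero_prod_def)
      then have "?\<gamma> (v + pi / 2) - ?\<gamma> (v - pi / 2) = 0"
        unfolding lissajous_def diff_Pair cos_chord by (simp add: zero_prod_def)
      then show False
        using periodic_inj_on_imp_sin_eq_0[OF lissajous_periodic inj, of "v + pi / 2" "v - pi / 2"] by simp
    qed
  qed
  show ?thesis
  proof (rule chord_embeddingI[where \<Phi> = "\<lambda>p. norm (W p)"])
    show "continuous_on UNIV (\<lambda>p. norm (W p))"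
      unfolding W_def split_def by (intro continuous_intros)
    show "\<bar>sin u\<bar> * norm (W (u, v)) \<le> norm (?\<gamma> (v + u) - ?\<gamma> (v - u))" for u v
      unfolding diff norm_scaleR by (simp add: abs_mult mult_right_mono)
  qed (use nz lissajous_periodic in auto)
qed

text \<open>At a double point \<open>t = v \<plusminus> u\<close> of the \<open>xy\<close>-projection, either \<open>sin (nx v) = sin (ny u) = 0\<close>
  or \<open>sin (ny v - A / nx) = sin (nx u) = 0\<close>. The weight \<open>(sin (nx ny t) / sin A)\<^sup>2\<close> is \<open>0\<close> in the first
  case and \<open>1\<close> in the second, so \<open>c\<close> and \<open>e\<close> govern the two kinds of crossings independently.\<close>

definition two_phase_z :: "real \<Rightarrow> real \<Rightarrow> real \<Rightarrow> real \<Rightarrow> real" where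
  "two_phase_z A c d t = cos (of_int nz * t + c)
     + (sin (of_int (nx * ny) * t) / sin A)\<^sup>2 * (cos (of_int nz * t + d) - cos (of_int nz * t + c))"

text \<open>The offset of \<open>e\<close> turns the condition at the second kind of crossing into
  \<open>sin (ny * e) \<noteq> 0\<close>, free of \<open>A\<close>, so that the admissible
  parameters \<open>(A, c, e)\<close> split into boxes.\<close>

definition two_phase :: "real \<Rightarrow> real \<Rightarrow> real \<Rightarrow> real \<Rightarrow> real \<times> real \<times> real" where
  "two_phase A c e t = (cos (of_int nx * t), cos (of_int ny * t - A / of_int nx),
     two_phase_z A c (e - of_int nz * A / of_int (nx * ny)) t)"

lemma two_phase_eq_lissajous:
  "two_phase A c (c + of_int nz * A / of_int (nx * ny)) = lissajous nx ny nz 0 (- A / of_int nx) c"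
  by (rule ext) (simp add: two_phase_def two_phase_z_def lissajous_def)

lemma two_phase_periodic: "two_phase A c e (t + 2 * pi) = two_phase A c e t"
proof -
  have "sin (of_int n * (t + 2 * pi)) = sin (of_int n * t)" for n :: int
    using cos_int_mult_periodic[of n t "- pi / 2"] by (simp add: cos_diff)
  then show ?thesis
    using cos_int_mult_periodic[of nx t 0] cos_int_mult_periodic[of ny t "- A / of_int nx"]
    by (simp add: two_phase_def two_phase_z_def cos_int_mult_periodic del: of_int_mult)
qed

text \<open>By the addition formulas every coordinate is a finite sum of coefficients depending
  continuously on \<open>A\<close>, \<open>c\<close>, \<open>e\<close> times fixed chord-Lipschitz
  functions of \<open>t\<close>, so convergence of the coefficients suffices.\<close>

lemma two_phase_perturb:
  fixes F :: "'p::t2_space filter"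
  assumes emb: "chord_embedding (two_phase A\<^sub>0 c\<^sub>0 e\<^sub>0)" and "sin A\<^sub>0 \<noteq> 0"
    and lim: "(A \<longlongrightarrow> A\<^sub>0) F" "(c \<longlongrightarrow> c\<^sub>0) F" "(e \<longlongrightarrow> e\<^sub>0) F"
  shows "\<forall>\<^sub>F p in F. knot_equiv (range (two_phase A\<^sub>0 c\<^sub>0 e\<^sub>0)) (range (two_phase (A p) (c p) (e p)))"
proof -
  have z: "two_phase_z A c d = (\<lambda>t. cos c * cos (of_int nz * t) + - sin c * sin (of_int nz * t)
      + (cos d - cos c) / (sin A)\<^sup>2
          * ((sin (of_int (nx * ny) * t) * sin (of_int (nx * ny) * t)) * cos (of_int nz * t))
      + (sin c - sin d) / (sin A)\<^sup>2
          * ((sin (of_int (nx * ny) * t) * sin (of_int (nx * ny) * t)) * sin (of_int nz * t)))" for A c d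
    unfolding two_phase_z_def
    by (rule ext) (simp add: cos_add power_divide power2_eq_square algebra_simps diff_divide_distrib
        add_divide_distrib)
  have y: "(\<lambda>t. cos (of_int ny * t - A / of_int nx)) = (\<lambda>t::real. cos (A / of_int nx) * cos (of_int ny * t)
      + sin (A / of_int nx) * sin (of_int ny * t))" for A
    by (rule ext) (simp add: cos_diff mult.commute)
  have x: "(\<lambda>t. cos (of_int nx * t)) = (\<lambda>t. 1 * cos (of_int nx * t))"
    by simp
  have x_lim: "chord_tendsto (\<lambda>p t. cos (of_int nx * t)) (\<lambda>t. cos (of_int nx * t)) F"
    by (subst (1 2) x) (intro chord_tendsto_mult tendsto_const chord_lipschitz_cos)
  have y_lim: "chord_tendsto (\<lambda>p t. cos (of_int ny * t - A p / of_int nx))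
      (\<lambda>t. cos (of_int ny * t - A\<^sub>0 / of_int nx)) F"
    unfolding y using freq_pos
    by (intro chord_tendsto_add chord_tendsto_mult chord_lipschitz_cos chord_lipschitz_sin
        tendsto_intros lim) auto
  have z_lim: "chord_tendsto (\<lambda>p. two_phase_z (A p) (c p) (e p - of_int nz * A p / of_int (nx * ny)))
      (two_phase_z A\<^sub>0 c\<^sub>0 (e\<^sub>0 - of_int nz * A\<^sub>0 / of_int (nx * ny))) F"
    unfolding z using freq_pos assms(2)
    by (intro chord_tendsto_add chord_tendsto_mult chord_lipschitz_mult chord_lipschitz_cos
        chord_lipschitz_sin tendsto_intros lim) auto
  show ?thesis
    using emb unfolding two_phase_def[abs_def] by (rule chord_embedding_perturb[OF _ x_lim y_lim z_lim])
qed

lemma lissajous_perturb: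
  fixes F :: "'p::t2_space filter"
  assumes emb: "chord_embedding (lissajous nx ny nz a\<^sub>0 b\<^sub>0 c\<^sub>0)"
    and lim: "(a \<longlongrightarrow> a\<^sub>0) F" "(b \<longlongrightarrow> b\<^sub>0) F" "(c \<longlongrightarrow> c\<^sub>0) F"
  shows "\<forall>\<^sub>F p in F. knot_equiv (range (lissajous nx ny nz a\<^sub>0 b\<^sub>0 c\<^sub>0))
    (range (lissajous nx ny nz (a p) (b p) (c p)))"
proof -
  have *: "chord_tendsto (\<lambda>p t. cos (of_int n * t + f p)) (\<lambda>t. cos (of_int n * t + f\<^sub>0)) F"
    if "(f \<longlongrightarrow> f\<^sub>0) F" for n :: int and f f\<^sub>0
  proof -
    have expand: "(\<lambda>t. cos (of_int n * t + b)) = (\<lambda>t::real. cos b * cos (of_int n * t) + - sin b * sin (of_int n * t))" for b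
      by (rule ext) (simp add: cos_add mult.commute)
    show ?thesis
      unfolding expand by (intro chord_tendsto_add chord_tendsto_mult chord_lipschitz_cos
          chord_lipschitz_sin tendsto_intros that)
  qed
  show ?thesis
    using emb unfolding lissajous_def[abs_def]
    by (rule chord_embedding_perturb[OF _ *[OF lim(1)] *[OF lim(2)] *[OF lim(3)]])
qed

text \<open>A vanishing \<open>W\<close> means equal heights over a double or singular point of the
  projection. Of the four cases, the first contradicts \<open>sin A \<noteq> 0\<close> and the
  second the coprimality of \<open>nx\<close> and \<open>ny\<close>; the last two are the two kinds
  of crossings, excluded by the conditions on \<open>c\<close> and \<open>e\<close>.\<close>

lemma two_phase_chord_embedding:
  assumes A: "sin A \<noteq> 0" and c: "sin (of_int nx * c) \<noteq> 0" and e: "sin (of_int ny * e) \<noteq> 0"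
  shows "chord_embedding (two_phase A c e)"
proof -
  let ?\<gamma> = "two_phase A c e"
  define d where "d = e - of_int nz * A / of_int (nx * ny)"
  define b where "b = - (A / of_int nx)"
  define z where "z = two_phase_z A c d"
  define W where "W = (\<lambda>(u, v). (- 2 * (sin (of_int nx * v) * sin_ratio (nat nx) u),
    - 2 * (sin (of_int ny * v + b) * sin_ratio (nat ny) u), z (v + u) - z (v - u)))"
  have diff: "?\<gamma> (v + u) - ?\<gamma> (v - u) = (sin u * fst (W (u, v)), sin u * fst (snd (W (u, v))), snd (snd (W (u, v))))"
    for u v
    using freq_pos cos_chord[of nx v u 0] cos_chord[of ny v u b]
    by (simp add: two_phase_def W_def z_def d_def b_def sin_int_mult_eq_sin_ratio)
  have nonzero: "W (u, v) \<noteq> 0" for u v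
  proof
    assume "W (u, v) = 0"
    then have xy: "sin (of_int nx * v) = 0 \<or> sin_ratio (nat nx) u = 0"
        "sin (of_int ny * v + b) = 0 \<or> sin_ratio (nat ny) u = 0"
      and zz: "z (v + u) = z (v - u)"
      unfolding W_def by (auto simp: zero_prod_def)
    have ratio: "sin (of_int n * u) = 0 \<and> sin u \<noteq> 0" if "sin_ratio (nat n) u = 0" "n > 0" for n
      using that sin_ratio_nonzero[of u "nat n"] by (auto simp: sin_int_mult_eq_sin_ratio)
    have sin2: "(sin (x + of_int k * pi))\<^sup>2 = (sin x)\<^sup>2" for x and k :: int
      by (metis abs_sin_add_int_pi power2_abs)
    \<comment> \<open>Over a crossing the height is a plain cosine. Coprimality with
      \<open>nz\<close> excludes \<open>sin (nz * u) = 0\<close>, so equal heights force the phase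
      at the midpoint to be a multiple of \<open>pi\<close>.\<close>
    have phase: "\<exists>i::int. of_int nz * v + f = of_int i * pi"
      if "\<And>t. t = v + u \<or> t = v - u \<Longrightarrow> z t = cos (of_int nz * t + f)"
        "sin (of_int n * u) = 0" "sin u \<noteq> 0" "coprime n nz" for f n
    proof -
      have "- 2 * sin (of_int nz * v + f) * sin (of_int nz * u) = 0"
        using zz that(1) unfolding cos_chord[symmetric] by simp
      moreover have "sin (of_int nz * u) \<noteq> 0"
        using that sin_coprime_multiples_eq_0 by blast
      ultimately show ?thesis
        using sin_zero_iff_int2 by auto
    qed
    consider "sin (of_int nx * v) = 0" "sin (of_int ny * v + b) = 0"
      | "sin_ratio (nat nx) u = 0" "sin_ratio (nat ny) u = 0"
      | "sin (of_int nx * v) = 0" "sin_ratio (nat ny) u = 0"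
      | "sin (of_int ny * v + b) = 0" "sin_ratio (nat nx) u = 0"
      using xy by blast
    then show False
    proof cases
      case 1
      then obtain i j :: int where "of_int nx * v = of_int i * pi" "of_int ny * v + b = of_int j * pi"
        using sin_zero_iff_int2 by blast
      \<comment> \<open>Eliminating \<open>v\<close> from the two conditions leaves \<open>A\<close>
        as a multiple of \<open>pi\<close>; the other crossing cases eliminate \<open>v\<close> in
        the same way.\<close>
      then have "of_int ny * (of_int nx * v) - of_int nx * (of_int ny * v + b) = of_int (ny * i - nx * j) * pi"
        by (simp add: algebra_simps)
      moreover have "of_int ny * (of_int nx * v) - of_int nx * (of_int ny * v + b) = A"
        using freq_pos by (simp add: b_def algebra_simps)
      ultimately show False
        using A sin_zero_iff_int2 by metis
    next
      case 2
      then show False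
        using ratio freq_pos sin_coprime_multiples_eq_0[OF freq_coprime(1)] by blast
    next
      case 3
      then obtain i j :: int where ij: "of_int nx * v = of_int i * pi" "of_int ny * u = of_int j * pi"
        using sin_zero_iff_int2 ratio freq_pos by meson
      have "z t = cos (of_int nz * t + c)" if "t = v + u \<or> t = v - u" for t
      proof -
        have "of_int (nx * ny) * (v + u) = of_int ny * (of_int nx * v) + of_int nx * (of_int ny * u)"
          "of_int (nx * ny) * (v - u) = of_int ny * (of_int nx * v) - of_int nx * (of_int ny * u)"
          by (simp_all add: algebra_simps)
        then have "of_int (nx * ny) * (v + u) = of_int (ny * i + nx * j) * pi"
          "of_int (nx * ny) * (v - u) = of_int (ny * i - nx * j) * pi"
          unfolding ij by (simp_all add: algebra_simps)
        then have "sin (of_int (nx * ny) * t) = 0"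
          using that sin_zero_iff_int2 by metis
        then show ?thesis
          by (simp add: z_def two_phase_z_def)
      qed
      then obtain k :: int where k: "of_int nz * v + c = of_int k * pi"
        using phase[of c ny] ratio[of ny] 3 freq_pos freq_coprime by blast
      have "of_int nx * c = of_int nx * (of_int nz * v + c) - of_int nz * (of_int nx * v)"
        by (simp add: algebra_simps)
      also have "\<dots> = of_int (nx * k - nz * i) * pi"
        unfolding k ij by (simp add: algebra_simps)
      finally show False
        using c sin_zero_iff_int2 by blast
    next
      case 4
      then obtain i j :: int where ij: "of_int ny * v + b = of_int i * pi" "of_int nx * u = of_int j * pi"
        using sin_zero_iff_int2 ratio freq_pos by meson
      have b: "of_int nx * b = - A"
        using freq_pos by (simp add: b_def)
      have "z t = cos (of_int nz * t + d)" if "t = v + u \<or> t = v - u" for t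
      proof -
        have "of_int (nx * ny) * (v + u) = of_int nx * (of_int ny * v + b) + of_int ny * (of_int nx * u) + A"
          "of_int (nx * ny) * (v - u) = of_int nx * (of_int ny * v + b) - of_int ny * (of_int nx * u) + A"
          using b by (simp_all add: algebra_simps)
        then have "of_int (nx * ny) * (v + u) = A + of_int (nx * i + ny * j) * pi"
          "of_int (nx * ny) * (v - u) = A + of_int (nx * i - ny * j) * pi"
          unfolding ij by (simp_all add: algebra_simps)
        then have "(sin (of_int (nx * ny) * t))\<^sup>2 = (sin A)\<^sup>2"
          using that sin2 by metis
        then show ?thesis
          using A by (simp add: z_def two_phase_z_def power_divide)
      qed
      then obtain k :: int where k: "of_int nz * v + d = of_int k * pi"
        using phase[of d nx] ratio[of nx] 4 freq_pos freq_coprime by blast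
      have "of_int ny * e = of_int ny * (of_int nz * v + d) - of_int nz * (of_int ny * v + b)"
        using freq_pos by (simp add: d_def b_def field_simps)
      also have "\<dots> = of_int (ny * k - nz * i) * pi"
        unfolding k ij by (simp add: algebra_simps)
      finally show False
        using e sin_zero_iff_int2 by blast
    qed
  qed
  show ?thesis
  proof (rule chord_embeddingI[where \<Phi> = "\<lambda>p. norm (W p)"])
    show "continuous_on UNIV (\<lambda>p. norm (W p))"
      unfolding W_def z_def two_phase_z_def split_def using A by (intro continuous_intros) auto
    show "\<bar>sin u\<bar> * norm (W (u, v)) \<le> norm (?\<gamma> (v + u) - ?\<gamma> (v - u))" for u v
      unfolding diff using abs_mult_norm_triple_le[OF abs_sin_le_one] by (metis prod.collapse)
  qed (use nonzero two_phase_periodic in auto)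
qed

end

section \<open>Cells of the phase space\<close>

text \<open>The nonzero sine removes the left endpoint that the floor would allow, so a cell is an
  open interval.\<close>

lemma sin_nonzero_floor_iff:
  "sin x \<noteq> 0 \<and> \<lfloor>x / pi\<rfloor> = k \<longleftrightarrow> of_int k * pi < x \<and> x < (of_int k + 1) * pi"
proof (intro iffI conjI)
  assume *: "sin x \<noteq> 0 \<and> \<lfloor>x / pi\<rfloor> = k"
  then have "of_int k \<le> x / pi" "x / pi < of_int k + 1"
    by linarith+
  moreover have "x \<noteq> of_int k * pi"
    using * sin_zero_iff_int2 by blast
  ultimately show "of_int k * pi < x" "x < (of_int k + 1) * pi"
    by (simp_all add: field_simps)
next
  assume *: "of_int k * pi < x \<and> x < (of_int k + 1) * pi"
  show "sin x \<noteq> 0"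
  proof
    assume "sin x = 0"
    then obtain i :: int where "x = of_int i * pi"
      using sin_zero_iff_int2 by blast
    with * have "k < i" "real_of_int i < of_int (k + 1)"
      by simp_all
    then show False
      unfolding of_int_less_iff by simp
  qed
  show "\<lfloor>x / pi\<rfloor> = k"
    using * by (simp add: floor_eq_iff field_simps)
qed

text \<open>Since \<open>x / pi\<close> is not an integer, negation exchanges floor and ceiling,
  which differ by one; hence the \<open>- 1\<close>.\<close>

lemma sin_neg_floor:
  assumes "sin x \<noteq> 0"
  shows "sin (- x + of_int m * pi) \<noteq> 0" "\<lfloor>(- x + of_int m * pi) / pi\<rfloor> = m - 1 - \<lfloor>x / pi\<rfloor>"
proof -
  have "of_int \<lfloor>x / pi\<rfloor> * pi < x \<and> x < (of_int \<lfloor>x / pi\<rfloor> + 1) * pi"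
    using assms sin_nonzero_floor_iff by blast
  then have "of_int (m - 1 - \<lfloor>x / pi\<rfloor>) * pi < - x + of_int m * pi
      \<and> - x + of_int m * pi < (of_int (m - 1 - \<lfloor>x / pi\<rfloor>) + 1) * pi"
    by (simp add: algebra_simps)
  then show "sin (- x + of_int m * pi) \<noteq> 0" "\<lfloor>(- x + of_int m * pi) / pi\<rfloor> = m - 1 - \<lfloor>x / pi\<rfloor>"
    using sin_nonzero_floor_iff by blast+
qed

lemma knot_equiv_reflected_range:
  fixes \<gamma> \<delta> :: "real \<Rightarrow> real \<times> real \<times> real"
  assumes "\<bar>\<alpha>\<bar> = 1" "\<bar>\<beta>\<bar> = 1" "\<bar>\<zeta>\<bar> = 1" "surj h"
    and "\<And>s. \<delta> (h s) = (\<lambda>(x, y, z). (\<alpha> * x, \<beta> * y, \<zeta> * z)) (\<gamma> s)"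
  shows "knot_equiv (range \<gamma>) (range \<delta>)"
proof -
  have "range \<delta> = range (\<lambda>s. \<delta> (h s))"
    using assms(4) by (metis image_image)
  also have "\<dots> = (\<lambda>(x, y, z). (\<alpha> * x, \<beta> * y, \<zeta> * z)) ` range \<gamma>"
    unfolding assms(5) by (simp add: image_image)
  finally show ?thesis
    using knot_equiv_reflection[OF assms(1-3)] by simp
qed

context pairwise_coprime_frequencies
begin

text \<open>Shifting \<open>c\<close> by \<open>i * pi\<close> and \<open>e\<close> by
  \<open>j * pi\<close> changes this number by \<open>nx * ny * (i - j)\<close>, so shifts with
  \<open>i - j\<close> even preserve it modulo \<open>2 * (nx * ny)\<close>.\<close>

definition cell_index :: "real \<Rightarrow> real \<Rightarrow> int" where
  "cell_index c e = ny * \<lfloor>of_int nx * c / pi\<rfloor> - nx * \<lfloor>of_int ny * e / pi\<rfloor>"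

definition generic :: "real \<Rightarrow> real \<Rightarrow> real \<Rightarrow> bool" where
  "generic A c e \<longleftrightarrow> 0 < A \<and> A < pi \<and> sin (of_int nx * c) \<noteq> 0 \<and> sin (of_int ny * e) \<noteq> 0"

text \<open>The parameters with given floors form an open box of embedded curves. The type is
  locally constant on it by the perturbation lemma, hence constant by connectedness.\<close>

lemma knot_equiv_same_cell:
  assumes gen: "generic A c e" "generic A' c' e'"
    and floors: "\<lfloor>of_int nx * c / pi\<rfloor> = \<lfloor>of_int nx * c' / pi\<rfloor>" "\<lfloor>of_int ny * e / pi\<rfloor> = \<lfloor>of_int ny * e' / pi\<rfloor>"
  shows "knot_equiv (range (two_phase A c e)) (range (two_phase A' c' e'))"
proof -
  define k l where "k = \<lfloor>of_int nx * c / pi\<rfloor>" and "l = \<lfloor>of_int ny * e / pi\<rfloor>"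
  define S where "S = {0<..<pi} \<times> {of_int k * pi / of_int nx<..<(of_int k + 1) * pi / of_int nx}
    \<times> {of_int l * pi / of_int ny<..<(of_int l + 1) * pi / of_int ny}"
  have S: "(A, c, e) \<in> S \<longleftrightarrow> generic A c e \<and> \<lfloor>of_int nx * c / pi\<rfloor> = k \<and> \<lfloor>of_int ny * e / pi\<rfloor> = l" for A c e
    using sin_nonzero_floor_iff[of "of_int nx * c" k] sin_nonzero_floor_iff[of "of_int ny * e" l] freq_pos
    by (auto simp: S_def generic_def pos_divide_less_eq pos_less_divide_eq mult.commute)
  let ?T = "\<lambda>(A, c, e). range (two_phase A c e)"
  have "knot_equiv (?T (A, c, e)) (?T (A', c', e'))"
  proof (rule connected_equivalence_relation[where R = "\<lambda>p q. knot_equiv (?T p) (?T q)"])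
    show "connected S"
      unfolding S_def by (intro convex_connected convex_Times convex_real_interval)
    show "(A, c, e) \<in> S" "(A', c', e') \<in> S"
      using gen floors by (simp_all add: S k_def l_def)
    show "\<exists>T. openin (top_of_set S) T \<and> p \<in> T \<and> (\<forall>q\<in>T. knot_equiv (?T p) (?T q))" if "p \<in> S" for p
    proof -
      obtain A\<^sub>0 c\<^sub>0 e\<^sub>0 where p: "p = (A\<^sub>0, c\<^sub>0, e\<^sub>0)"
        by (metis surj_pair)
      with that have gen\<^sub>0: "0 < A\<^sub>0" "A\<^sub>0 < pi" "sin (of_int nx * c\<^sub>0) \<noteq> 0" "sin (of_int ny * e\<^sub>0) \<noteq> 0"
        by (auto simp: S generic_def)
      then have "sin A\<^sub>0 \<noteq> 0"
        using sin_gt_zero by force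
      have id: "((\<lambda>q. q) \<longlongrightarrow> p) (nhds p)"
        by (rule filterlim_ident)
      have "\<forall>\<^sub>F q in nhds p. knot_equiv (range (two_phase A\<^sub>0 c\<^sub>0 e\<^sub>0))
          (range (two_phase (fst q) (fst (snd q)) (snd (snd q))))"
        using tendsto_fst[OF id] tendsto_fst[OF tendsto_snd[OF id]] tendsto_snd[OF tendsto_snd[OF id]]
        by (intro two_phase_perturb two_phase_chord_embedding \<open>sin A\<^sub>0 \<noteq> 0\<close> gen\<^sub>0) (simp_all add: p)
      then obtain U where "open U" "p \<in> U" "\<And>q. q \<in> U \<Longrightarrow> knot_equiv (?T p) (?T q)"
        unfolding eventually_nhds by (auto simp: p split_def)
      then show ?thesis
        using that by (intro exI[of _ "S \<inter> U"]) auto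
    qed
  qed (use knot_equiv_sym knot_equiv_trans in blast)+
  then show ?thesis
    by simp
qed

text \<open>Equal parity gives both cosines in \<open>two_phase_z\<close> the same sign, which
  factors out as a reflection in the third coordinate.\<close>

lemma knot_equiv_shift_phases:
  assumes "even (i - j)"
  shows "knot_equiv (range (two_phase A c e)) (range (two_phase A (c + of_int i * pi) (e + of_int j * pi)))"
proof -
  obtain m where m: "i = j + 2 * m"
    using assms by (metis add.commute diff_add_cancel dvdE)
  have "cos (of_int i * pi) = cos (of_int j * pi + of_int m * (2 * pi))"
    unfolding m by (simp add: algebra_simps)
  then have same: "cos (of_int i * pi) = cos (of_int j * pi)"
    by (simp only: periodic_add_int_multiple[where \<gamma> = cos, OF cos_periodic])
  have "two_phase_z A (c + of_int i * pi) (e + of_int j * pi - d) t = cos (of_int i * pi) * two_phase_z A c (e - d) t"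
    for t d
  proof -
    have "of_int nz * t + (c + of_int i * pi) = (of_int nz * t + c) + of_int i * pi"
      "of_int nz * t + (e + of_int j * pi - d) = (of_int nz * t + (e - d)) + of_int j * pi"
      by simp_all
    then show ?thesis
      unfolding two_phase_z_def by (simp only: cos_add_int_pi same) (simp add: algebra_simps)
  qed
  then show ?thesis
    by (intro knot_equiv_reflected_range[where \<alpha> = 1 and \<beta> = 1 and \<zeta> = "cos (of_int i * pi)" and h = id])
      (simp_all add: abs_cos_int_pi two_phase_def)
qed

text \<open>Coprimality of \<open>nx\<close> and \<open>ny\<close> forces the floors to differ by
  \<open>nx * i\<close> and \<open>ny * j\<close>, and the modulus makes \<open>i - j\<close> even.
  The corresponding shift of phases moves one cell onto the other.\<close>

lemma knot_equiv_cell_index_cong: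
  assumes gen: "generic A c e" "generic A' c' e'"
    and cong: "2 * (nx * ny) dvd cell_index c e - cell_index c' e'"
  shows "knot_equiv (range (two_phase A c e)) (range (two_phase A' c' e'))"
proof -
  define k l k' l' where defs: "k = \<lfloor>of_int nx * c / pi\<rfloor>" "l = \<lfloor>of_int ny * e / pi\<rfloor>"
    "k' = \<lfloor>of_int nx * c' / pi\<rfloor>" "l' = \<lfloor>of_int ny * e' / pi\<rfloor>"
  obtain m where m: "ny * k - nx * l - (ny * k' - nx * l') = 2 * (nx * ny) * m"
    using cong unfolding cell_index_def defs by blast
  have "ny * (k - k') = nx * ((l - l') + 2 * ny * m)" "nx * (l - l') = ny * ((k - k') - 2 * nx * m)"
    using m by (simp_all add: algebra_simps)
  then have "nx dvd k - k'" "ny dvd l - l'"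
    using freq_coprime(1) by (metis coprime_dvd_mult_right_iff dvd_triv_left,
      metis coprime_commute coprime_dvd_mult_right_iff dvd_triv_left)
  then obtain i j where ij: "k - k' = nx * i" "l - l' = ny * j"
    by blast
  have "nx * ny * (i - j) = nx * ny * (2 * m)"
    using m ij by algebra
  then have "i - j = 2 * m"
    using freq_pos by simp
  then have "even (i - j)"
    by simp
  have "of_int nx * (c' + of_int i * pi) / pi = of_int nx * c' / pi + of_int (nx * i)"
    "of_int ny * (e' + of_int j * pi) / pi = of_int ny * e' / pi + of_int (ny * j)"
    by (simp_all add: field_simps)
  then have floors: "\<lfloor>of_int nx * (c' + of_int i * pi) / pi\<rfloor> = k" "\<lfloor>of_int ny * (e' + of_int j * pi) / pi\<rfloor> = l"
    using ij by (simp_all only: floor_add_int[symmetric] defs[symmetric])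
  have "of_int nx * (c' + of_int i * pi) = of_int nx * c' + of_int (nx * i) * pi"
    "of_int ny * (e' + of_int j * pi) = of_int ny * e' + of_int (ny * j) * pi"
    by (simp_all add: algebra_simps)
  then have "generic A' (c' + of_int i * pi) (e' + of_int j * pi)"
    using gen(2) unfolding generic_def by (metis abs_sin_add_int_pi abs_eq_0)
  then have "knot_equiv (range (two_phase A c e)) (range (two_phase A' (c' + of_int i * pi) (e' + of_int j * pi)))"
    using gen(1) floors by (intro knot_equiv_same_cell) (simp_all add: defs)
  then show ?thesis
    by (rule knot_equiv_trans[OF _ knot_equiv_sym[OF knot_equiv_shift_phases[OF \<open>even (i - j)\<close>]]])
qed

section \<open>Normal form, time reversal and generic phases\<close>

lemma lissajous_normal_form:
  assumes "sin (of_int ny * a - of_int nx * b) \<noteq> 0" "sin (of_int nz * a - of_int nx * c) \<noteq> 0"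
    "sin (of_int nz * b - of_int ny * c) \<noteq> 0"
  obtains A c' where "generic A c' (c' + of_int nz * A / of_int (nx * ny))"
    "knot_equiv (range (lissajous nx ny nz a b c)) (range (lissajous nx ny nz 0 (- A / of_int nx) c'))"
proof -
  define \<theta> where "\<theta> = of_int ny * a - of_int nx * b"
  define n where "n = \<lfloor>\<theta> / pi\<rfloor>"
  define A where "A = \<theta> - of_int n * pi"
  have A: "0 < A" "A < pi"
    using sin_nonzero_floor_iff[of \<theta> n] assms(1) by (simp_all add: \<theta>_def n_def A_def algebra_simps)
  \<comment> \<open>Adding \<open>i * pi\<close> to \<open>a\<close> and \<open>j * pi\<close> to
    \<open>b\<close> lowers \<open>\<theta>\<close> by \<open>n * pi\<close>, into the interval from
    0 to \<open>pi\<close>; Bezout supplies such \<open>i\<close> and \<open>j\<close>. The shift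
    \<open>\<tau>\<close> of the parameter then removes the phase of the first coordinate, and
    reflections absorb the added multiples of \<open>pi\<close>.\<close>
  obtain p q where "p * nx + q * ny = 1"
    using bezout_int[of nx ny] freq_coprime(1) by auto
  then have "ny * (- q * n) + n = nx * (p * n)"
    by algebra
  then obtain i j where ij: "ny * i + n = nx * j"
    by blast
  define \<tau> where "\<tau> = (a + of_int i * pi) / of_int nx"
  define c' where "c' = c - of_int nz * \<tau>"
  have nx\<tau>: "of_int nx * \<tau> = a + of_int i * pi"
    using freq_pos by (simp add: \<tau>_def)
  have "real_of_int ny * of_int i + of_int n = of_int nx * of_int j"
    using ij by (metis of_int_add of_int_mult)
  then have nij: "of_int n = of_int nx * of_int j - real_of_int ny * of_int i"
    by simp
  have "A = of_int ny * (of_int nx * \<tau>) - of_int nx * b - of_int nx * of_int j * pi"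
    unfolding A_def \<theta>_def nij nx\<tau> by (simp add: algebra_simps)
  then have Anx: "A / of_int nx = of_int ny * \<tau> - b - of_int j * pi"
    using freq_pos by (simp add: field_simps)
  have "of_int nx * c' = of_int nx * c - of_int nz * (of_int nx * \<tau>)"
    by (simp add: c'_def algebra_simps)
  also have "\<dots> = - (of_int nz * a - of_int nx * c) + of_int (- nz * i) * pi"
    unfolding nx\<tau> by (simp add: algebra_simps)
  finally have "sin (of_int nx * c') \<noteq> 0"
    using sin_neg_floor(1)[OF assms(2)] by metis
  moreover have "of_int ny * (c' + of_int nz * A / of_int (nx * ny)) = of_int ny * c' + of_int nz * (A / of_int nx)"
    using freq_pos by (simp add: field_simps)
  then have "of_int ny * (c' + of_int nz * A / of_int (nx * ny))
      = - (of_int nz * b - of_int ny * c) + of_int (- nz * j) * pi"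
    unfolding Anx c'_def by (simp add: algebra_simps)
  then have "sin (of_int ny * (c' + of_int nz * A / of_int (nx * ny))) \<noteq> 0"
    using sin_neg_floor(1)[OF assms(3)] by metis
  ultimately have "generic A c' (c' + of_int nz * A / of_int (nx * ny))"
    using A by (simp add: generic_def)
  moreover have "knot_equiv (range (lissajous nx ny nz a b c)) (range (lissajous nx ny nz 0 (- A / of_int nx) c'))"
  proof (rule knot_equiv_reflected_range[where \<alpha> = "cos (of_int i * pi)" and \<beta> = "cos (of_int j * pi)"
        and \<zeta> = 1 and h = "\<lambda>s. s + \<tau>"])
    fix s
    have "of_int nx * (s + \<tau>) + 0 = (of_int nx * s + a) + of_int i * pi"
      "of_int ny * (s + \<tau>) + - A / of_int nx = (of_int ny * s + b) + of_int j * pi"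
      "of_int nz * (s + \<tau>) + c' = of_int nz * s + c"
      using nx\<tau> Anx by (simp_all add: c'_def algebra_simps)
    then show "lissajous nx ny nz 0 (- A / of_int nx) c' (s + \<tau>)
        = (\<lambda>(x, y, z). (cos (of_int i * pi) * x, cos (of_int j * pi) * y, 1 * z)) (lissajous nx ny nz a b c s)"
      unfolding lissajous_def by (simp only: cos_add_int_pi prod.case mult_1)
  qed (auto simp: abs_cos_int_pi intro: surjI[of _ "\<lambda>s. s - \<tau>"])
  ultimately show ?thesis
    using that by blast
qed

text \<open>Reversing the parameter negates \<open>A\<close>, \<open>c\<close> and \<open>e\<close>;
  Bezout integers with \<open>nx * p - ny * i = 1\<close> bring \<open>- A\<close> back to
  \<open>pi - A\<close>. In the index the negated floors contribute \<open>nx - ny\<close> and the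
  Bezout shifts contribute \<open>- nz\<close>.\<close>

lemma two_phase_time_reversal:
  assumes gen: "generic A c e" and e: "e = c + of_int nz * A / of_int (nx * ny)"
  obtains A' c' e' where "generic A' c' e'" "cell_index c' e' = nx - ny - nz - cell_index c e"
    "knot_equiv (range (two_phase A c e)) (range (two_phase A' c' e'))"
proof -
  obtain p q where pq: "p * nx + q * ny = 1"
    using bezout_int[of nx ny] freq_coprime(1) by auto
  define i where "i = - q"
  have ij: "nx * p - ny * i = 1"
    using pq by (simp add: i_def algebra_simps)
  then have "real_of_int (nx * p - ny * i) = 1"
    by simp
  then have ij': "real_of_int nx * of_int p = 1 + of_int ny * of_int i"
    by simp
  define A' where "A' = pi - A"
  define c' where "c' = - c + of_int nz * of_int i * pi / of_int nx"
  define e' where "e' = c' + of_int nz * A' / of_int (nx * ny)"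
  have c': "of_int nx * c' = - (of_int nx * c) + of_int (nz * i) * pi"
    using freq_pos by (simp add: c'_def field_simps)
  have "of_int nx * (of_int ny * e') = of_int ny * (of_int nx * c') + of_int nz * A'"
    using freq_pos by (simp add: e'_def field_simps)
  also have "\<dots> = - (of_int nx * of_int ny * c + of_int nz * A) + of_int nz * (1 + of_int ny * of_int i) * pi"
    unfolding c' A'_def by (simp add: algebra_simps)
  also have "\<dots> = of_int nx * (- (of_int ny * e) + of_int (nz * p) * pi)"
    unfolding ij'[symmetric] using freq_pos by (simp add: e field_simps)
  finally have e': "of_int ny * e' = - (of_int ny * e) + of_int (nz * p) * pi"
    using freq_pos by simp
  have "generic A' c' e'"
    using gen sin_neg_floor(1)[of "of_int nx * c" "nz * i"] sin_neg_floor(1)[of "of_int ny * e" "nz * p"]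
    unfolding generic_def A'_def c' e' by simp
  moreover have "cell_index c' e' = nx - ny - nz - cell_index c e"
  proof -
    have "cell_index c' e' = ny * (nz * i - 1 - \<lfloor>of_int nx * c / pi\<rfloor>) - nx * (nz * p - 1 - \<lfloor>of_int ny * e / pi\<rfloor>)"
      using gen unfolding generic_def cell_index_def c' e' by (simp only: sin_neg_floor(2) not_False_eq_True)
    also have "\<dots> = nx - ny - nz * (nx * p - ny * i) - cell_index c e"
      by (simp add: cell_index_def algebra_simps)
    finally show ?thesis
      by (simp add: ij)
  qed
  moreover have "knot_equiv (range (two_phase A c e)) (range (two_phase A' c' e'))"
    unfolding e e'_def two_phase_eq_lissajous
  proof (rule knot_equiv_reflected_range[where \<alpha> = "cos (of_int (- i) * pi)" and \<beta> = "cos (of_int (- p) * pi)"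
        and \<zeta> = 1 and h = "\<lambda>s. - s - of_int i * pi / of_int nx"])
    fix s
    let ?h = "- s - of_int i * pi / of_int nx"
    have "of_int nx * (of_int ny * ?h + - A' / of_int nx)
        = of_int nx * (- (of_int ny * s + - A / of_int nx)) - (1 + of_int ny * of_int i) * pi"
      using freq_pos by (simp add: A'_def field_simps)
    also have "\<dots> = of_int nx * (- (of_int ny * s + - A / of_int nx) + of_int (- p) * pi)"
      unfolding ij'[symmetric] by (simp add: algebra_simps)
    finally have "of_int ny * ?h + - A' / of_int nx = - (of_int ny * s + - A / of_int nx) + of_int (- p) * pi"
      using freq_pos by simp
    moreover have "of_int nx * ?h + 0 = - (of_int nx * s + 0) + of_int (- i) * pi"
      "of_int nz * ?h + c' = - (of_int nz * s + c)"
      using freq_pos by (simp_all add: c'_def field_simps)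
    ultimately show "lissajous nx ny nz 0 (- A' / of_int nx) c' ?h
        = (\<lambda>(x, y, z). (cos (of_int (- i) * pi) * x, cos (of_int (- p) * pi) * y, 1 * z))
            (lissajous nx ny nz 0 (- A / of_int nx) c s)"
      unfolding lissajous_def by (simp only: cos_add_int_pi cos_minus prod.case mult_1)
  next
    show "surj (\<lambda>s. - s - of_int i * pi / of_int nx)"
      by (rule surjI[of _ "\<lambda>s. - s - of_int i * pi / of_int nx"]) simp
  qed (simp_all only: abs_cos_int_pi abs_one)
  ultimately show ?thesis
    using that by blast
qed

text \<open>An embedded curve may still have phases on a wall where one of the three sines vanishes.
  A line transverse to all walls meets them in countably many points, so arbitrarily small
  displacements along it avoid them.\<close>

lemma lissajous_perturb_generic:
  assumes "chord_embedding (lissajous nx ny nz a b c)"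
  obtains a' b' where "sin (of_int ny * a' - of_int nx * b') \<noteq> 0" "sin (of_int nz * a' - of_int nx * c) \<noteq> 0"
    "sin (of_int nz * b' - of_int ny * c) \<noteq> 0"
    "knot_equiv (range (lissajous nx ny nz a b c)) (range (lissajous nx ny nz a' b' c))"
proof -
  \<comment> \<open>Moving \<open>a\<close> and \<open>b\<close> in opposite directions gives the
    first sine the slope \<open>ny + nx\<close>, which is positive; equal directions would give
    \<open>ny - nx\<close>, which is zero when \<open>nx = ny = 1\<close>.\<close>
  have "((\<lambda>s. a + s) \<longlongrightarrow> a + 0) (at_right 0)" "((\<lambda>s. b - s) \<longlongrightarrow> b - 0) (at_right 0)"
    by (intro tendsto_intros)+
  then have "\<forall>\<^sub>F s in at_right 0. knot_equiv (range (lissajous nx ny nz a b c))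
      (range (lissajous nx ny nz (a + s) (b - s) c))"
    by (intro lissajous_perturb assms tendsto_const) simp_all
  then obtain \<delta> where \<delta>: "\<delta> > 0" "\<And>s. 0 < s \<Longrightarrow> s < \<delta> \<Longrightarrow> knot_equiv (range (lissajous nx ny nz a b c))
      (range (lissajous nx ny nz (a + s) (b - s) c))"
    unfolding eventually_at_right_field by blast
  have countable: "countable {s. sin (\<alpha> + \<beta> * s) = 0}" if "\<beta> \<noteq> 0" for \<alpha> \<beta> :: real
  proof (rule countable_subset)
    show "{s. sin (\<alpha> + \<beta> * s) = 0} \<subseteq> range (\<lambda>i::int. (of_int i * pi - \<alpha>) / \<beta>)"
    proof
      fix s
      assume "s \<in> {s. sin (\<alpha> + \<beta> * s) = 0}"
      then obtain i :: int where "\<alpha> + \<beta> * s = of_int i * pi"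
        using sin_zero_iff_int2 by blast
      then have "s = (of_int i * pi - \<alpha>) / \<beta>"
        using that by (simp add: field_simps)
      then show "s \<in> range (\<lambda>i::int. (of_int i * pi - \<alpha>) / \<beta>)"
        by blast
    qed
  qed simp
  define B where "B = {s. sin ((of_int ny * a - of_int nx * b) + (of_int ny + of_int nx) * s) = 0}
    \<union> {s. sin ((of_int nz * a - of_int nx * c) + of_int nz * s) = 0}
    \<union> {s. sin ((of_int nz * b - of_int ny * c) + (- of_int nz) * s) = 0}"
  have "countable B"
    unfolding B_def using freq_pos by (intro countable_Un countable) simp_all
  moreover have "uncountable {0<..<\<delta>}"
    using \<delta>(1) by (simp add: uncountable_open_interval)
  ultimately obtain s where s: "s \<in> {0<..<\<delta>}" "s \<notin> B"
    using countable_subset[of "{0<..<\<delta>}" B] by blast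
  show ?thesis
  proof (rule that[of "a + s" "b - s"])
    show "knot_equiv (range (lissajous nx ny nz a b c)) (range (lissajous nx ny nz (a + s) (b - s) c))"
      using \<delta>(2) s(1) by simp
  qed (use s(2) in \<open>simp_all add: B_def algebra_simps\<close>)
qed

text \<open>The index is centred so that time reversal changes its sign.\<close>

definition has_index :: "int \<Rightarrow> (real \<times> real \<times> real) set \<Rightarrow> bool" where
  "has_index D K \<longleftrightarrow> (\<exists>A c e. generic A c e \<and> knot_equiv K (range (two_phase A c e))
     \<and> 4 * (nx * ny) dvd D - (2 * cell_index c e - (nx - ny - nz)))"

section \<open>Counting knot types by the centred index\<close>

lemma has_index_unique_type:
  assumes "has_index D K" "has_index D L"
  shows "knot_equiv K L"
proof -
  obtain A c e A' c' e' where
    K: "generic A c e" "knot_equiv K (range (two_phase A c e))"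
      "4 * (nx * ny) dvd D - (2 * cell_index c e - (nx - ny - nz))"
    and L: "generic A' c' e'" "knot_equiv L (range (two_phase A' c' e'))"
      "4 * (nx * ny) dvd D - (2 * cell_index c' e' - (nx - ny - nz))"
    using assms unfolding has_index_def by blast
  have "2 * (2 * (nx * ny)) dvd 2 * (cell_index c e - cell_index c' e')"
    using dvd_diff[OF L(3) K(3)] by (simp add: algebra_simps)
  then have "2 * (nx * ny) dvd cell_index c e - cell_index c' e'"
    by (simp only: dvd_mult_cancel_left) simp
  then have "knot_equiv (range (two_phase A c e)) (range (two_phase A' c' e'))"
    by (rule knot_equiv_cell_index_cong[OF K(1) L(1)])
  then show ?thesis
    by (rule knot_equiv_trans[OF knot_equiv_trans[OF K(2)] knot_equiv_sym[OF L(2)]])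
qed

text \<open>Time reversal shows that a knot of centred index \<open>D\<close> also has index
  \<open>- D\<close>. Modulo \<open>4 * N\<close> these are represented by \<open>r\<close> and
  \<open>4 * N - r\<close>, one of which is at most \<open>2 * N\<close>; the parity is that of
  \<open>nx - ny - nz\<close> for both.\<close>

lemma lissajous_knot_has_index:
  assumes "K \<in> lissajous_knots nx ny nz"
  obtains D where "0 \<le> D" "D \<le> 2 * (nx * ny)" "even (D - (nx - ny - nz))" "has_index D K"
proof -
  define M where "M = nx - ny - nz"
  define N where "N = nx * ny"
  have "N > 0"
    using freq_pos by (simp add: N_def)
  obtain a b c where K: "K = range (lissajous nx ny nz a b c)" "inj_on (lissajous nx ny nz a b c) {0..<2 * pi}"
    using assms unfolding lissajous_knots_eq by blast
  obtain a' b' where ab: "sin (of_int ny * a' - of_int nx * b') \<noteq> 0" "sin (of_int nz * a' - of_int nx * c) \<noteq> 0"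
    "sin (of_int nz * b' - of_int ny * c) \<noteq> 0"
    "knot_equiv K (range (lissajous nx ny nz a' b' c))"
    using lissajous_perturb_generic[OF lissajous_chord_embedding[OF K(2)]] unfolding K(1) by metis
  obtain A c' where "generic A c' (c' + of_int nz * A / of_int N)"
    "knot_equiv (range (lissajous nx ny nz a' b' c)) (range (lissajous nx ny nz 0 (- A / of_int nx) c'))"
    using lissajous_normal_form[OF ab(1-3)] unfolding N_def by metis
  then obtain e where e: "generic A c' e" "e = c' + of_int nz * A / of_int N"
    "knot_equiv K (range (two_phase A c' e))"
    using knot_equiv_trans[OF ab(4)] unfolding N_def two_phase_eq_lissajous[symmetric] by blast
  obtain A' c'' e'' where r: "generic A' c'' e''" "cell_index c'' e'' = M - cell_index c' e"
    "knot_equiv (range (two_phase A c' e)) (range (two_phase A' c'' e''))"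
    using two_phase_time_reversal[OF e(1)] e(2) unfolding N_def M_def by metis
  define D where "D = 2 * cell_index c' e - M"
  define r where "r = D mod (4 * N)"
  have bounds: "0 \<le> r" "r < 4 * N"
    using \<open>N > 0\<close> by (simp_all add: r_def)
  have dvd: "4 * N dvd r - D"
    unfolding r_def by (metis dvd_minus_mod dvd_minus_iff minus_diff_eq)
  then obtain q where q: "r = D + 4 * N * q"
    by (metis add.commute diff_add_cancel dvdE)
  have even: "even (r - M)"
    unfolding q D_def by simp
  show ?thesis
  proof (cases "r \<le> 2 * N")
    case True
    have "has_index r K"
      using e dvd unfolding has_index_def D_def M_def N_def by blast
    then show ?thesis
      using that[of r] True bounds even by (simp add: M_def N_def)
  next
    case False
    have "4 * N dvd (4 * N - r) - (2 * cell_index c'' e'' - M)"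
      unfolding r(2) q D_def by (simp add: algebra_simps)
    then have "has_index (4 * N - r) K"
      using r(1) knot_equiv_trans[OF e(3) r(3)] unfolding has_index_def M_def N_def by blast
    moreover have "even (4 * N - r - M)"
      using even by presburger
    ultimately show ?thesis
      using that[of "4 * N - r"] False bounds by (simp add: M_def N_def)
  qed
qed

lemma lissajous_types_bound:
  "finite (lissajous_types nx ny nz)" "card (lissajous_types nx ny nz) \<le> nat (nx * ny + 1)"
proof -
  define E where "E = {D. 0 \<le> D \<and> D \<le> 2 * (nx * ny) \<and> even (D - (nx - ny - nz))}"
  \<comment> \<open>Any set of index \<open>D\<close> may represent the class, since all of them are
    equivalent. An index that no set has contributes an arbitrary class, which is harmless for an
    upper bound.\<close>
  define cls where "cls D = {(K, L). knot_equiv K L} `` {SOME K. has_index D K}" for D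
  \<comment> \<open>Halving is injective on integers of one parity, so at most
    \<open>nx * ny + 1\<close> indices are available.\<close>
  have "inj_on (\<lambda>D. D div 2) E"
  proof (rule inj_onI)
    fix D D'
    assume "D \<in> E" "D' \<in> E" "D div 2 = D' div 2"
    then have "even (D - (nx - ny - nz))" "even (D' - (nx - ny - nz))" "D div 2 = D' div 2"
      unfolding E_def by simp_all
    then show "D = D'"
      by presburger
  qed
  moreover have "(\<lambda>D. D div 2) ` E \<subseteq> {0..nx * ny}"
    unfolding E_def by auto
  ultimately have E: "finite E" "card E \<le> nat (nx * ny + 1)"
    using card_inj_on_le[of _ E "{0..nx * ny}"] inj_on_finite[of _ E "{0..nx * ny}"] by fastforce+
  have sub: "lissajous_types nx ny nz \<subseteq> cls ` E"
  proof
    fix X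
    assume "X \<in> lissajous_types nx ny nz"
    then obtain K where K: "K \<in> lissajous_knots nx ny nz" "X = {(K, L). knot_equiv K L} `` {K}"
      unfolding lissajous_types_def by (auto elim: quotientE)
    obtain D where D: "D \<in> E" "has_index D K"
      using lissajous_knot_has_index[OF K(1)] unfolding E_def by blast
    then have "knot_equiv K (SOME K. has_index D K)"
      using has_index_unique_type by (metis someI)
    then have "X = cls D"
      unfolding K(2) cls_def using knot_equiv_sym knot_equiv_trans by blast
    then show "X \<in> cls ` E"
      using D(1) by blast
  qed
  show "finite (lissajous_types nx ny nz)"
    using sub E(1) finite_surj by blast
  have "card (lissajous_types nx ny nz) \<le> card E"
    using sub E(1) by (rule surj_card_le[rotated])
  then show "card (lissajous_types nx ny nz) \<le> nat (nx * ny + 1)"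
    using E(2) by linarith
qed

end

theorem theorem1:
  fixes nx ny nz :: int
  assumes "nx > 0" "ny > 0" "nz > 0"
    and "coprime nx ny" "coprime nx nz" "coprime ny nz"
  shows "finite (lissajous_types nx ny nz)
         \<and> card (lissajous_types nx ny nz) \<le> nat (2 * nx * ny)
         \<and> (nx = 2 \<longrightarrow> card (lissajous_types nx ny nz) \<le> nat (2 * ny + 1))"
proof -
  interpret pairwise_coprime_frequencies nx ny nz
    using assms by unfold_locales
  \<comment> \<open>The bound \<open>nx * ny + 1\<close> is at most \<open>2 * nx * ny\<close>
    because \<open>nx * ny\<close> is at least 1, and it equals \<open>2 * ny + 1\<close> when
    \<open>nx = 2\<close>.\<close>
  have "nx * ny \<ge> 1"
    using assms(1,2) by (simp add: int_one_le_iff_zero_less)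
  then have "nat (nx * ny + 1) \<le> nat (2 * nx * ny)"
    by (intro nat_mono) simp
  then show ?thesis
    using lissajous_types_bound by (auto intro: order_trans)
qed

end
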